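(* Let $X$ be a normed linear space, let $Y$ be a closed proper non-trivial subspace of $X$, let $x\in X\setminus\{0\}$, and let $\delta\in[0,1)$. Put \[ \widetilde m_\delta(x,Y):=\inf\bigl\{\|f|_Y\|: f\in S_{X^*},\ |f(x)|\ge(1-\delta)\|x\|\bigr\}, \] \[ m_\delta(x,Y):=\inf\bigl\{\|f|_Y\|: f\in B_{X^*},\ |f(x)|\ge(1-\delta)\|x\|\bigr\}, \] and suppose $\widetilde m_\delta(x,Y)<1-\delta$. Then: (a) $x\notin Y$, and both infima are attained. (b) The set $S:=\bigl\{\varepsilon\in[0,(1-\delta)^2): x\perp_\delta^\varepsilon Y\bigr\}$ has a least element $\varepsilon_{\min}$, and $\varepsilon_{\min}=(1-\delta)\,\widetilde m_\delta(x,Y)$. (c) $(1-\delta)\,m_\delta(x,Y)\le\varepsilon_{\min}\le m_\delta(x,Y)$, and $x\perp_\delta^{m_\delta(x,Y)}Y$ whenever $m_\delta(x,Y)<(1-\delta)^2$.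
   Context: All normed linear spaces are over $\mathbb{C}$. $X^*$ is the topological dual of $X$; $B_{X^*}$ and $S_{X^*}$ are its closed unit ball and unit sphere. $\|f|_Y\|$ is the norm of the restriction of $f$ to $Y$, as a functional on $Y$. For $\delta,\varepsilon\in[0,1)$ with $\varepsilon<(1-\delta)^2$ and $x,y\in X$, one writes $x\perp_\delta^\varepsilon y$ if there exists $f\in X^*\setminus\{0\}$ with $|f(x)|\ge(1-\delta)\|f\|\|x\|$ and $|f(y)|\le\frac{\varepsilon}{1-\delta}\|f\|\|y\|$. For a subspace $Y$, $x\perp_\delta^\varepsilon Y$ means $x\perp_\delta^\varepsilon y$ for every $y\in Y$. *)

theory Defs
  imports "HOL-Analysis.Analysis"
begin

text \<open>Complex normed spaces. The real structure inherited from \<open>real_normed_vector\<close> is the one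
  obtained by restricting the scalars, so that the library topology, norm, \<open>bounded_linear\<close> and
  \<open>onorm\<close> apply.\<close>

class complex_normed_vector = real_normed_vector +
  fixes scaleC :: "complex \<Rightarrow> 'a \<Rightarrow> 'a" (infixr "*\<^sub>C" 75)
  assumes scaleC_add_right: "a *\<^sub>C (x + y) = a *\<^sub>C x + a *\<^sub>C y"
    and scaleC_add_left: "(a + b) *\<^sub>C x = a *\<^sub>C x + b *\<^sub>C x"
    and scaleC_scaleC: "a *\<^sub>C (b *\<^sub>C x) = (a * b) *\<^sub>C x"
    and scaleC_of_real: "complex_of_real r *\<^sub>C x = r *\<^sub>R x"
    and norm_scaleC: "norm (a *\<^sub>C x) = cmod a * norm x"

global_interpretation complex_vector:
  vector_space "scaleC :: complex \<Rightarrow> 'a \<Rightarrow> 'a::complex_normed_vector"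
  defines csubspace_raw_def: csubspace = complex_vector.subspace
proof
  show "1 *\<^sub>C x = x" for x :: 'a
    using scaleC_of_real[of 1 x] by simp
qed (simp_all add: scaleC_add_right scaleC_add_left scaleC_scaleC)

instantiation complex :: complex_normed_vector
begin

definition scaleC_complex :: "complex \<Rightarrow> complex \<Rightarrow> complex" where
  "scaleC_complex a x = a * x"

instance
  by standard (simp_all add: scaleC_complex_def algebra_simps norm_mult scaleR_conv_of_real)

end

definition dual :: "('a::complex_normed_vector \<Rightarrow> complex) set" where
  "dual = {f. bounded_linear f \<and> (\<forall>c x. f (c *\<^sub>C x) = c * f x)}"

definition dual_sphere :: "('a::complex_normed_vector \<Rightarrow> complex) set" where
  "dual_sphere = {f \<in> dual. onorm f = 1}"

definition dual_ball :: "('a::complex_normed_vector \<Rightarrow> complex) set" where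
  "dual_ball = {f \<in> dual. onorm f \<le> 1}"

text \<open>The norm of the restriction of \<open>f\<close> to \<open>Y\<close>: the library's \<open>onorm\<close> with the
  supremum taken over \<open>Y\<close> only. The point \<open>0\<close> contributes \<open>0 / 0 = 0\<close>.\<close>

definition onorm_on :: "'a::complex_normed_vector set \<Rightarrow> ('a \<Rightarrow> complex) \<Rightarrow> real" where
  "onorm_on Y f = (SUP y\<in>Y. norm (f y) / norm y)"

lemma onorm_on_UNIV: "onorm_on UNIV f = onorm f"
  by (simp add: onorm_on_def onorm_def)

definition norming ::
  "('a::complex_normed_vector \<Rightarrow> complex) set \<Rightarrow> real \<Rightarrow> 'a \<Rightarrow> ('a \<Rightarrow> complex) set" where
  "norming A \<delta> x = {f \<in> A. cmod (f x) \<ge> (1 - \<delta>) * norm x}"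

definition m_tilde :: "real \<Rightarrow> 'a::complex_normed_vector \<Rightarrow> 'a set \<Rightarrow> real" where
  "m_tilde \<delta> x Y = (INF f\<in>norming dual_sphere \<delta> x. onorm_on Y f)"

definition m_ball :: "real \<Rightarrow> 'a::complex_normed_vector \<Rightarrow> 'a set \<Rightarrow> real" where
  "m_ball \<delta> x Y = (INF f\<in>norming dual_ball \<delta> x. onorm_on Y f)"

text \<open>Approximate Birkhoff--James orthogonality of \<open>x\<close> to \<open>y\<close>; meaningful for
  \<open>0 \<le> \<delta> < 1\<close> and \<open>0 \<le> \<epsilon> < (1 - \<delta>)\<^sup>2\<close>, which users of the definition must ensure.\<close>

definition approx_orth ::
  "real \<Rightarrow> real \<Rightarrow> 'a::complex_normed_vector \<Rightarrow> 'a \<Rightarrow> bool" where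
  "approx_orth \<delta> \<epsilon> x y \<longleftrightarrow>
    (\<exists>f\<in>dual - {\<lambda>_. 0}. cmod (f x) \<ge> (1 - \<delta>) * onorm f * norm x \<and>
      cmod (f y) \<le> \<epsilon> / (1 - \<delta>) * onorm f * norm y)"

definition approx_orth_subspace ::
  "real \<Rightarrow> real \<Rightarrow> 'a::complex_normed_vector \<Rightarrow> 'a set \<Rightarrow> bool" where
  "approx_orth_subspace \<delta> \<epsilon> x Y \<longleftrightarrow> (\<forall>y\<in>Y. approx_orth \<delta> \<epsilon> x y)"

end

theory Submission
  imports Defs
begin

text \<open>For a closed subspace \<open>Y\<close> and \<open>\<mu> \<ge> 0\<close>, the functionals \<open>f\<close> with \<open>\<bar>f\<bar> \<le> 1\<close> on the unit ball of
  the space and \<open>\<bar>f\<bar> \<le> \<mu>\<close> on the unit ball of \<open>Y\<close> are exactly those dominated by the seminorm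
  \<open>p\<^sub>\<mu> z = inf {norm (z - y) + \<mu> * norm y | y \<in> Y}\<close>. By the Hahn--Banach theorem one of
  them satisfies \<open>\<bar>f x\<bar> \<ge> a\<close> if and only if \<open>a \<le> norm (x - y) + \<mu> * norm y\<close> for every
  \<open>y \<in> Y\<close> (\<open>restricted_norming_functional\<close>). The right-hand side is a condition on one \<open>y\<close> at
  a time and is closed in \<open>\<mu>\<close>, and this gives two things at once.

  First, the infimum over the ball is attained (\<open>m_ball_attained\<close>): the condition holds for every
  \<open>\<mu>\<close> above the infimum, hence at the infimum; no weak-star compactness is involved.

  Second, if \<open>x\<close> is approximately orthogonal to each \<open>y \<in> Y\<close> through a functional that may depend on
  \<open>y\<close>, then the condition holds with \<open>\<mu> = \<epsilon> / (1 - \<delta>)\<close>, so a single functional serves all of \<open>Y\<close>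
  (\<open>m_ball_le_if_approx_orth_subspace\<close>).

  The infimum over the sphere adds nothing new. The assumption \<open>m_tilde \<delta> x Y < 1 - \<delta>\<close> forces
  \<open>x \<notin> Y\<close>, so some functional \<open>g\<close> vanishes on \<open>Y\<close> but not at \<open>x\<close>. Adding a multiple of \<open>g\<close>
  with the right phase to a functional of the ball leaves its restriction to \<open>Y\<close> alone,
  does not decrease its modulus at \<open>x\<close>, and can bring its norm up to exactly \<open>1\<close>
  (\<open>push_to_sphere\<close>). Hence \<open>m_tilde \<delta> x Y = m_ball \<delta> x Y\<close>, with both infima attained, and the
  minimal \<open>\<epsilon>\<close> is \<open>1 - \<delta>\<close> times this common value.\<close>

section \<open>The Hahn--Banach theorem for sublinear functionals\<close>

definition sublinear :: "('a::real_vector \<Rightarrow> real) \<Rightarrow> bool" where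
  "sublinear q \<longleftrightarrow> (\<forall>x y. q (x + y) \<le> q x + q y) \<and> (\<forall>t>0. \<forall>x. q (t *\<^sub>R x) \<le> t * q x)"

lemma sublinear_add: "sublinear q \<Longrightarrow> q (x + y) \<le> q x + q y"
  and sublinear_scale_le: "sublinear q \<Longrightarrow> t > 0 \<Longrightarrow> q (t *\<^sub>R x) \<le> t * q x"
  by (auto simp: sublinear_def)

lemma sublinear_zero:
  assumes "sublinear q" shows "q 0 = 0"
  using sublinear_scale_le[OF assms, of 2 0] sublinear_scale_le[OF assms, of "1/2" 0] by simp

lemma sublinear_scale:
  assumes "sublinear q" and "t \<ge> 0" shows "q (t *\<^sub>R x) = t * q x"
proof (cases "t = 0")
  case True
  then show ?thesis using sublinear_zero[OF assms(1)] by simp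
next
  case False
  with assms(2) have t: "t > 0" by simp
  have "q x \<le> q (t *\<^sub>R x) / t"
    using sublinear_scale_le[OF assms(1), of "1/t" "t *\<^sub>R x"] t by simp
  then show ?thesis
    using sublinear_scale_le[OF assms(1) t, of x] t by (simp add: field_simps)
qed

lemma sublinear_uminus: "sublinear q \<Longrightarrow> - q (- x) \<le> q x"
  using sublinear_add[of q x "- x"] sublinear_zero[of q] by simp

lemma add_cINF_ge:
  fixes f :: "'a \<Rightarrow> real" and g :: "'b \<Rightarrow> real"
  assumes "A \<noteq> {}" "B \<noteq> {}" and "\<And>a b. a \<in> A \<Longrightarrow> b \<in> B \<Longrightarrow> c \<le> f a + g b"
  shows "c \<le> (INF a\<in>A. f a) + (INF b\<in>B. g b)"
proof -
  have "c - f a \<le> (INF b\<in>B. g b)" if "a \<in> A" for a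
    using assms that by (intro cINF_greatest) (auto simp: algebra_simps)
  then have "c - (INF b\<in>B. g b) \<le> (INF a\<in>A. f a)"
    using assms(1) by (intro cINF_greatest) (auto simp: algebra_simps)
  then show ?thesis by simp
qed

lemma mult_cINF_ge:
  fixes f :: "'a \<Rightarrow> real"
  assumes "A \<noteq> {}" "t > 0" and "\<And>a. a \<in> A \<Longrightarrow> c \<le> t * f a"
  shows "c \<le> t * (INF a\<in>A. f a)"
proof -
  have "c / t \<le> (INF a\<in>A. f a)"
    using assms by (intro cINF_greatest) (auto simp: field_simps)
  then show ?thesis using assms(2) by (simp add: field_simps)
qed

text \<open>The largest sublinear functional below \<open>q\<close> that is additive in the direction \<open>v\<close>, that is,
  whose value at \<open>- v\<close> is at most \<open>- q v\<close>.\<close>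

definition flatten :: "('a::real_vector \<Rightarrow> real) \<Rightarrow> 'a \<Rightarrow> 'a \<Rightarrow> real" where
  "flatten q v z = (INF t\<in>{0..}. q (z + t *\<^sub>R v) - t * q v)"

lemma flatten_le:
  assumes q: "sublinear q" and "t \<ge> 0"
  shows "flatten q v z \<le> q (z + t *\<^sub>R v) - t * q v"
  unfolding flatten_def
proof (rule cINF_lower)
  show "bdd_below ((\<lambda>t. q (z + t *\<^sub>R v) - t * q v) ` {0..})"
  proof (rule bdd_belowI2)
    fix t :: real assume "t \<in> {0..}"
    then have "t * q v = q ((z + t *\<^sub>R v) + - z)" using sublinear_scale[OF q] by simp
    also have "\<dots> \<le> q (z + t *\<^sub>R v) + q (- z)" by (rule sublinear_add[OF q])
    finally show "- q (- z) \<le> q (z + t *\<^sub>R v) - t * q v" by simp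
  qed
qed (use assms in simp)

lemma sublinear_flatten:
  assumes q: "sublinear q" shows "sublinear (flatten q v)"
  unfolding sublinear_def
proof (intro conjI allI impI)
  fix z w
  show "flatten q v (z + w) \<le> flatten q v z + flatten q v w"
    unfolding flatten_def[of q v z] flatten_def[of q v w]
  proof (rule add_cINF_ge)
    fix t s :: real assume ts: "t \<in> {0..}" "s \<in> {0..}"
    have "flatten q v (z + w) \<le> q ((z + w) + (t + s) *\<^sub>R v) - (t + s) * q v"
      using ts by (intro flatten_le[OF q]) simp
    also have "(z + w) + (t + s) *\<^sub>R v = (z + t *\<^sub>R v) + (w + s *\<^sub>R v)"
      by (simp add: algebra_simps)
    also have "q \<dots> \<le> q (z + t *\<^sub>R v) + q (w + s *\<^sub>R v)" by (rule sublinear_add[OF q])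
    finally show "flatten q v (z + w)
        \<le> (q (z + t *\<^sub>R v) - t * q v) + (q (w + s *\<^sub>R v) - s * q v)"
      by (simp add: algebra_simps)
  qed auto
next
  fix r :: real and z assume r: "r > 0"
  show "flatten q v (r *\<^sub>R z) \<le> r * flatten q v z"
    unfolding flatten_def[of q v z]
  proof (rule mult_cINF_ge)
    fix t :: real assume t: "t \<in> {0..}"
    have "flatten q v (r *\<^sub>R z) \<le> q (r *\<^sub>R z + (r * t) *\<^sub>R v) - (r * t) * q v"
      using t r by (intro flatten_le[OF q]) simp
    also have "r *\<^sub>R z + (r * t) *\<^sub>R v = r *\<^sub>R (z + t *\<^sub>R v)" by (simp add: algebra_simps)
    also have "q \<dots> \<le> r * q (z + t *\<^sub>R v)" by (rule sublinear_scale_le[OF q r])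
    finally show "flatten q v (r *\<^sub>R z) \<le> r * (q (z + t *\<^sub>R v) - t * q v)"
      by (simp add: algebra_simps)
  qed (use r in auto)
qed

lemma flatten_le_self: "sublinear q \<Longrightarrow> flatten q v z \<le> q z"
  using flatten_le[of q 0 v z] by simp

text \<open>Flattening a minimal sublinear functional in a direction \<open>v\<close> cannot change it, so it is
  already additive in every direction.\<close>

lemma minimal_sublinear_is_linear:
  assumes q: "sublinear q" and min: "\<And>r. sublinear r \<Longrightarrow> (\<And>z. r z \<le> q z) \<Longrightarrow> r = q"
  shows "linear q"
proof -
  have flat: "flatten q v = q" for v
    using min[OF sublinear_flatten[OF q]] flatten_le_self[OF q] by blast
  (* The term t = 1 of the infimum that defines the flattening gives superadditivity. *)
  have add: "q (z + v) = q z + q v" for z v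
    using flatten_le[OF q, of 1 v z] sublinear_add[OF q, of z v] flat[of v] by simp
  have neg: "q (- z) = - q z" for z
    using add[of z "- z"] sublinear_zero[OF q] by simp
  have "q (r *\<^sub>R z) = r * q z" for r z
  proof (cases "r \<ge> 0")
    case True
    then show ?thesis by (rule sublinear_scale[OF q])
  next
    case False
    then have "q ((- r) *\<^sub>R z) = (- r) * q z" by (intro sublinear_scale[OF q]) simp
    then show ?thesis using neg[of "r *\<^sub>R z"] by simp
  qed
  with add show ?thesis by (intro linearI) auto
qed

text \<open>The infimum of a chain is finite because every sublinear \<open>r \<le> p\<close> satisfies
  \<open>r z \<ge> - r (- z) \<ge> - p (- z)\<close>, and it is subadditive because two members of a chain are both
  bounded below by one of them. Hence Zorn's lemma applies.\<close>

lemma exists_minimal_sublinear: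
  assumes p: "sublinear p"
  shows "\<exists>q. sublinear q \<and> (\<forall>z. q z \<le> p z) \<and> (\<forall>r. sublinear r \<longrightarrow> (\<forall>z. r z \<le> q z) \<longrightarrow> r = q)"
proof -
  define A where "A = {q. sublinear q \<and> q \<le> p}"
  have "\<exists>q\<in>A. \<forall>r\<in>A. q \<ge> r \<longrightarrow> r = q"
  proof (rule predicate_Zorn)
    show "partial_order_on A (relation_of (\<ge>) A)"
      by (rule partial_order_on_relation_ofI) auto
  next
    fix C assume C: "C \<in> Chains (relation_of (\<ge>) A)"
    then have CA: "q \<in> A" if "q \<in> C" for q
      using that by (auto simp: Chains_def relation_of_def)
    have chain: "r \<le> q \<or> q \<le> r" if "q \<in> C" "r \<in> C" for q r
      using C that by (auto simp: Chains_def relation_of_def)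
    show "\<exists>u\<in>A. \<forall>q\<in>C. q \<ge> u"
    proof (cases "C = {}")
      case True
      then show ?thesis using p by (auto simp: A_def)
    next
      case False
      define u where "u z = (INF q\<in>C. q z)" for z
      have u_le: "u z \<le> q z" if "q \<in> C" for q z
        unfolding u_def
      proof (rule cINF_lower[OF _ that], rule bdd_belowI2)
        fix r assume "r \<in> C"
        then have "sublinear r" "r (- z) \<le> p (- z)" using CA by (auto simp: A_def le_fun_def)
        then show "- p (- z) \<le> r z" using sublinear_uminus[of r z] by simp
      qed
      have "sublinear u"
        unfolding sublinear_def
      proof (intro conjI allI impI)
        fix z w
        show "u (z + w) \<le> u z + u w"
          unfolding u_def[of z] u_def[of w]
        proof (rule add_cINF_ge[OF False False])
          fix q r assume qr: "q \<in> C" "r \<in> C"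
          then obtain s where s: "s \<in> C" "s \<le> q" "s \<le> r" using chain[OF qr] by blast
          then have "sublinear s" using CA by (auto simp: A_def)
          then have "s (z + w) \<le> s z + s w" by (rule sublinear_add)
          moreover have "s z \<le> q z" "s w \<le> r w" using s by (auto simp: le_fun_def)
          ultimately show "u (z + w) \<le> q z + r w" using u_le[OF s(1), of "z + w"] by linarith
        qed
      next
        fix t :: real and z assume t: "t > 0"
        show "u (t *\<^sub>R z) \<le> t * u z"
          unfolding u_def[of z]
        proof (rule mult_cINF_ge[OF False t])
          fix q assume q: "q \<in> C"
          then have "sublinear q" using CA by (auto simp: A_def)
          then show "u (t *\<^sub>R z) \<le> t * q z"
            using sublinear_scale_le[OF _ t, of q z] u_le[OF q, of "t *\<^sub>R z"] by linarith
        qed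
      qed
      moreover have "u \<le> p"
      proof -
        obtain q where "q \<in> C" using False by blast
        then show ?thesis using u_le[of q] CA[of q] by (force simp: A_def le_fun_def intro: order_trans)
      qed
      ultimately show ?thesis using u_le by (auto simp: A_def le_fun_def)
    qed
  qed
  then obtain q where "q \<in> A" and "\<And>r. r \<in> A \<Longrightarrow> r \<le> q \<Longrightarrow> r = q" by blast
  then show ?thesis unfolding A_def le_fun_def by (blast intro: order_trans)
qed

text \<open>Flattening \<open>p\<close> at \<open>x\<close> first makes every functional below it take at \<open>- x\<close> a value
  at most \<open>- p x\<close>.\<close>

theorem hahn_banach_sublinear:
  assumes p: "sublinear p"
  shows "\<exists>u. linear u \<and> (\<forall>z. u z \<le> p z) \<and> u x = p x"
proof -
  obtain q where q: "sublinear q" "\<And>z. q z \<le> flatten p x z"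
      "\<And>r. sublinear r \<Longrightarrow> (\<And>z. r z \<le> q z) \<Longrightarrow> r = q"
    using exists_minimal_sublinear[OF sublinear_flatten[OF p, of x]] by blast
  have lin: "linear q" using minimal_sublinear_is_linear q(1,3) by blast
  have le: "q z \<le> p z" for z using q(2)[of z] flatten_le_self[OF p, of x z] by linarith
  have "q (- x) \<le> - p x"
    using q(2)[of "- x"] flatten_le[OF p, of 1 x "- x"] sublinear_zero[OF p] by simp
  then have "p x \<le> q x" using linear_neg[OF lin, of x] by simp
  then show ?thesis using lin le by (intro exI[of _ q]) (auto intro: antisym)
qed

section \<open>Complex functionals dominated by a seminorm\<close>

lemma scaleC_minus_one: "(- 1) *\<^sub>C z = - (z :: 'a::complex_normed_vector)"
  using scaleC_of_real[of "- 1" z] by simp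

lemma dual_scaleC: "f \<in> dual \<Longrightarrow> f (c *\<^sub>C z) = c * f z"
  and dual_bounded_linear: "f \<in> dual \<Longrightarrow> bounded_linear f"
  by (auto simp: dual_def)

text \<open>The functional is \<open>u z - \<i> * u (\<i> z)\<close> for a real linear \<open>u \<le> p\<close>. Rotating \<open>z\<close> so that this
  value becomes real turns the bound on \<open>u\<close> into one on the modulus.\<close>

theorem hahn_banach_seminorm:
  fixes p :: "'a::complex_normed_vector \<Rightarrow> real"
  assumes add: "\<And>z w. p (z + w) \<le> p z + p w"
    and scale: "\<And>c z. p (c *\<^sub>C z) \<le> cmod c * p z"
    and le_norm: "\<And>z. p z \<le> norm z"
  shows "\<exists>f\<in>dual. (\<forall>z. cmod (f z) \<le> p z) \<and> p x \<le> cmod (f x)"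
proof -
  have "sublinear p"
    unfolding sublinear_def
  proof (intro conjI allI impI)
    show "p (t *\<^sub>R z) \<le> t * p z" if "t > 0" for t z
      using scale[of "complex_of_real t" z] that by (simp add: scaleC_of_real)
  qed (rule add)
  then obtain u where lin: "linear u" and u_le: "\<And>z. u z \<le> p z" and u_x: "u x = p x"
    using hahn_banach_sublinear by blast
  define f where "f z = Complex (u z) (- u (\<i> *\<^sub>C z))" for z
  have f_add: "f (z + w) = f z + f w" for z w
    by (simp add: f_def linear_add[OF lin] scaleC_add_right complex_eq_iff)
  have u_scaleC: "u (c *\<^sub>C z) = Re c * u z + Im c * u (\<i> *\<^sub>C z)" for c z
  proof -
    have "c *\<^sub>C z = Re c *\<^sub>R z + Im c *\<^sub>R (\<i> *\<^sub>C z)"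
      unfolding scaleC_of_real[symmetric] scaleC_scaleC scaleC_add_left[symmetric]
      by (simp add: complex_eq_iff)
    then show ?thesis by (simp add: linear_add[OF lin] linear_scale[OF lin])
  qed
  have f_scale: "f (c *\<^sub>C z) = c * f z" for c z
    using u_scaleC[of c z] u_scaleC[of "\<i> * c" z]
    by (simp add: f_def scaleC_scaleC complex_eq_iff)
  have f_le: "cmod (f z) \<le> p z" for z
  proof -
    define c where "c = cnj (sgn (f z))"
    have "c * f z = complex_of_real (cmod (f z))"
      by (cases "f z = 0")
        (simp_all add: c_def sgn_eq complex_norm_square[symmetric] power2_eq_square field_simps
          flip: of_real_mult)
    then have "cmod (f z) = Re (f (c *\<^sub>C z))" by (simp add: f_scale)
    also have "\<dots> \<le> p (c *\<^sub>C z)" using u_le by (simp add: f_def)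
    also have "\<dots> \<le> cmod c * p z" by (rule scale)
    also have "\<dots> \<le> p z"
    proof -
      have "0 \<le> p z" using \<open>sublinear p\<close> sublinear_uminus[of p z] scale[of "- 1" z]
        by (simp add: scaleC_minus_one)
      then show ?thesis by (simp add: c_def norm_sgn)
    qed
    finally show ?thesis .
  qed
  have "bounded_linear f"
  proof (rule bounded_linear_intro[where K = 1])
    show "f (r *\<^sub>R z) = r *\<^sub>R f z" for r z
      using f_scale[of "complex_of_real r" z] by (simp add: scaleC_of_real scaleR_conv_of_real)
    show "norm (f z) \<le> norm z * 1" for z using order_trans[OF f_le le_norm, of z] by simp
  qed (rule f_add)
  then have "f \<in> dual" using f_scale by (simp add: dual_def)
  moreover have "p x \<le> cmod (f x)" using complex_Re_le_cmod[of "f x"] u_x by (simp add: f_def)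
  ultimately show ?thesis using f_le by blast
qed

section \<open>Functionals that are small on a subspace\<close>

lemma dual_norm_le: "f \<in> dual \<Longrightarrow> cmod (f z) \<le> onorm f * norm z"
  using onorm[of f z] by (simp add: dual_def)

lemma dual_ball_norm_le: "f \<in> dual_ball \<Longrightarrow> cmod (f z) \<le> norm z"
  using dual_norm_le[of f z] mult_right_mono[of "onorm f" 1 "norm z"] by (simp add: dual_ball_def)

lemma dual_ballI: "f \<in> dual \<Longrightarrow> (\<And>z. cmod (f z) \<le> norm z) \<Longrightarrow> f \<in> dual_ball"
  using onorm_bound[of 1 f] by (simp add: dual_ball_def)

lemma dual_sphere_subset_ball: "dual_sphere \<subseteq> dual_ball"
  by (auto simp: dual_sphere_def dual_ball_def)

lemma dual_norm_le_onorm_on: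
  assumes "f \<in> dual" "y \<in> Y"
  shows "cmod (f y) \<le> onorm_on Y f * norm y"
proof (cases "y = 0")
  case True
  then show ?thesis using dual_norm_le[OF assms(1), of y] by simp
next
  case False
  have "norm (f y) / norm y \<le> onorm_on Y f"
    unfolding onorm_on_def
  proof (rule cSUP_upper[OF assms(2)], rule bdd_aboveI2)
    show "norm (f z) / norm z \<le> onorm f" for z
      using le_onorm[of f z] assms(1) by (simp add: dual_def)
  qed
  then show ?thesis using False by (simp add: field_simps)
qed

lemma onorm_on_le:
  assumes "Y \<noteq> {}" "0 \<le> \<mu>" and "\<And>y. y \<in> Y \<Longrightarrow> cmod (f y) \<le> \<mu> * norm y"
  shows "onorm_on Y f \<le> \<mu>"
  unfolding onorm_on_def
proof (rule cSUP_least[OF assms(1)])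
  fix y assume "y \<in> Y"
  then show "norm (f y) / norm y \<le> \<mu>"
    using assms by (cases "y = 0") (auto simp: field_simps)
qed

lemma onorm_on_nonneg:
  assumes "f \<in> dual" "csubspace Y" shows "0 \<le> onorm_on Y f"
proof -
  have "0 \<in> Y" using assms(2) by (rule complex_vector.subspace_0)
  then have "norm (f 0) / norm (0::'a) \<le> onorm_on Y f"
    unfolding onorm_on_def
  proof (rule cSUP_upper, intro bdd_aboveI2)
    show "norm (f z) / norm z \<le> onorm f" for z
      using le_onorm[of f z] assms(1) by (simp add: dual_def)
  qed
  then show ?thesis by simp
qed

lemma onorm_on_cong: "(\<And>y. y \<in> Y \<Longrightarrow> f y = g y) \<Longrightarrow> onorm_on Y f = onorm_on Y g"
  by (simp add: onorm_on_def)

text \<open>Both bounds on \<open>f\<close> together amount to domination by one seminorm \<open>p\<close>, the infimal convolution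
  of \<open>norm\<close> on the whole space with \<open>\<mu> * norm\<close> on \<open>Y\<close>. The hypothesis says \<open>a \<le> p x\<close>, and the
  Hahn--Banach theorem supplies an \<open>f\<close> that reaches \<open>p x\<close>.\<close>

theorem restricted_norming_functional:
  fixes x :: "'a::complex_normed_vector"
  assumes Y: "csubspace Y" and \<mu>: "0 \<le> \<mu>"
    and a: "\<And>y. y \<in> Y \<Longrightarrow> a \<le> norm (x - y) + \<mu> * norm y"
  obtains f where "f \<in> dual_ball" "a \<le> cmod (f x)" "\<And>y. y \<in> Y \<Longrightarrow> cmod (f y) \<le> \<mu> * norm y"
proof -
  define p where "p z = (INF y\<in>Y. norm (z - y) + \<mu> * norm y)" for z
  have 0: "0 \<in> Y" using Y by (rule complex_vector.subspace_0)
  then have ne: "Y \<noteq> {}" by blast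
  have p_le: "p z \<le> norm (z - y) + \<mu> * norm y" if "y \<in> Y" for z y
    unfolding p_def
    by (rule cINF_lower[OF _ that], rule bdd_belowI2[of _ 0]) (use \<mu> in simp)
  have "\<exists>f\<in>dual. (\<forall>z. cmod (f z) \<le> p z) \<and> p x \<le> cmod (f x)"
  proof (rule hahn_banach_seminorm)
    fix z w
    show "p (z + w) \<le> p z + p w"
      unfolding p_def[of z] p_def[of w]
    proof (rule add_cINF_ge[OF ne ne])
      fix y y' assume "y \<in> Y" "y' \<in> Y"
      then have "p (z + w) \<le> norm ((z + w) - (y + y')) + \<mu> * norm (y + y')"
        by (intro p_le complex_vector.subspace_add[OF Y])
      also have "(z + w) - (y + y') = (z - y) + (w - y')" by simp
      also have "norm \<dots> \<le> norm (z - y) + norm (w - y')" by (rule norm_triangle_ineq)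
      also have "\<mu> * norm (y + y') \<le> \<mu> * (norm y + norm y')"
        by (intro mult_left_mono norm_triangle_ineq \<mu>)
      finally show "p (z + w) \<le> (norm (z - y) + \<mu> * norm y) + (norm (w - y') + \<mu> * norm y')"
        by (simp add: algebra_simps)
    qed
  next
    fix c z
    show "p (c *\<^sub>C z) \<le> cmod c * p z"
    proof (cases "c = 0")
      case True
      then show ?thesis using p_le[OF 0, of "c *\<^sub>C z"] by (simp add: norm_scaleC)
    next
      case False
      show ?thesis
        unfolding p_def[of z]
      proof (rule mult_cINF_ge[OF ne])
        fix y assume "y \<in> Y"
        then have "p (c *\<^sub>C z) \<le> norm (c *\<^sub>C z - c *\<^sub>C y) + \<mu> * norm (c *\<^sub>C y)"
          by (intro p_le complex_vector.subspace_scale[OF Y])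
        also have "norm (c *\<^sub>C z - c *\<^sub>C y) = cmod c * norm (z - y)"
          by (simp only: norm_scaleC flip: complex_vector.scale_right_diff_distrib)
        finally show "p (c *\<^sub>C z) \<le> cmod c * (norm (z - y) + \<mu> * norm y)"
          by (simp add: norm_scaleC distrib_left mult.left_commute)
      qed (use False in simp)
    qed
  next
    show "p z \<le> norm z" for z using p_le[OF 0, of z] by simp
  qed
  then obtain f where f: "f \<in> dual" "\<And>z. cmod (f z) \<le> p z" "p x \<le> cmod (f x)" by blast
  show ?thesis
  proof
    show "f \<in> dual_ball"
      by (rule dual_ballI[OF f(1)]) (use order_trans[OF f(2) p_le[OF 0]] in simp)
    have "a \<le> p x" unfolding p_def by (rule cINF_greatest[OF ne a])
    then show "a \<le> cmod (f x)" using f(3) by simp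
    show "cmod (f y) \<le> \<mu> * norm y" if "y \<in> Y" for y
      using order_trans[OF f(2) p_le[OF that], of y] by simp
  qed
qed

text \<open>The converse: the triangle inequality for \<open>f x = f (x - y) + f y\<close>.\<close>

lemma dual_ball_split_norm:
  assumes "f \<in> dual_ball" "cmod (f y) \<le> b"
  shows "cmod (f x) \<le> norm (x - y) + b"
proof -
  have "f x = f (x - y) + f y"
    using assms(1) by (simp add: dual_ball_def dual_def bounded_linear.linear linear_diff)
  then have "cmod (f x) \<le> cmod (f (x - y)) + cmod (f y)" by (metis norm_triangle_ineq)
  then show ?thesis using dual_ball_norm_le[OF assms(1), of "x - y"] assms(2) by linarith
qed

text \<open>With \<open>\<mu> = 1\<close> in \<open>restricted_norming_functional\<close> the dominating seminorm is the norm itself.\<close>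

lemma exists_norming_functional:
  fixes x :: "'a::complex_normed_vector"
  assumes "x \<noteq> 0" obtains f where "f \<in> dual_sphere" "cmod (f x) = norm x"
proof -
  have "norm x \<le> norm (x - y) + 1 * norm y" for y
    using norm_triangle_ineq[of "x - y" y] by simp
  then obtain f where f: "f \<in> dual_ball" "norm x \<le> cmod (f x)"
    using restricted_norming_functional[OF complex_vector.subspace_UNIV, of 1 "norm x" x]
    by (metis zero_le_one)
  then have dual: "f \<in> dual" "onorm f \<le> 1" by (auto simp: dual_ball_def)
  have "norm x \<le> onorm f * norm x" using f(2) dual_norm_le[OF dual(1), of x] by linarith
  then have "1 \<le> onorm f" using assms by simp
  then show ?thesis
    using that[of f] dual f(2) dual_ball_norm_le[OF f(1), of x] by (simp add: dual_sphere_def)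
qed

text \<open>With \<open>\<mu> = 0\<close> the dominating seminorm is the distance to \<open>Y\<close>, which is positive at \<open>x\<close>.\<close>

lemma exists_annihilator:
  fixes x :: "'a::complex_normed_vector"
  assumes Y: "csubspace Y" "closed Y" and "x \<notin> Y"
  obtains g where "g \<in> dual" "g x \<noteq> 0" "\<And>y. y \<in> Y \<Longrightarrow> g y = 0"
proof -
  have ne: "Y \<noteq> {}" using complex_vector.subspace_0[OF Y(1)] by blast
  have "infdist x Y \<le> norm (x - y) + 0 * norm y" if "y \<in> Y" for y
    using infdist_le[OF that, of x] by (simp add: dist_norm)
  then obtain g where g: "g \<in> dual_ball" "infdist x Y \<le> cmod (g x)"
      "\<And>y. y \<in> Y \<Longrightarrow> cmod (g y) \<le> 0 * norm y"
    using restricted_norming_functional[OF Y(1), of 0 "infdist x Y" x] by auto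
  have "infdist x Y > 0"
    using infdist_pos_not_in_closed[OF Y(2) ne assms(3)] .
  then have "g x \<noteq> 0" using g(2) by auto
  then show ?thesis using that[of g] g by (simp add: dual_ball_def)
qed

lemma dual_add_scaled:
  assumes f: "f \<in> dual" and g: "g \<in> dual"
  shows "(\<lambda>z. f z + c * g z) \<in> dual"
  using assms
  by (auto simp: dual_def distrib_left intro!: bounded_linear_add bounded_linear_const_mult)

text \<open>With the phase of \<open>g\<close> aligned to that of \<open>f\<close> at \<open>x\<close>, the norm of \<open>f + t * g\<close> is continuous
  and unbounded in \<open>t \<ge> 0\<close> and starts at \<open>onorm f \<le> 1\<close>, so it equals \<open>1\<close> for some \<open>t\<close>; meanwhile
  the modulus at \<open>x\<close> does not decrease and the restriction to \<open>Y\<close> stays fixed.\<close>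

lemma push_to_sphere:
  fixes x :: "'a::complex_normed_vector"
  assumes f: "f \<in> dual_ball" and g: "g \<in> dual" "g x \<noteq> 0" "\<And>y. y \<in> Y \<Longrightarrow> g y = 0"
  obtains h where "h \<in> dual_sphere" "cmod (f x) \<le> cmod (h x)" "\<And>y. y \<in> Y \<Longrightarrow> h y = f y"
proof -
  have fd: "f \<in> dual" and f1: "onorm f \<le> 1" using f by (auto simp: dual_ball_def)
  define s where "s = (if f x = 0 then 1 else sgn (f x))"
  (* c rotates g x onto the ray of f x (any ray if f x = 0), so that the moduli at x add up. *)
  define c where "c = s * cnj (sgn (g x))"
  have s: "cmod s = 1" "f x = complex_of_real (cmod (f x)) * s"
    by (simp_all add: s_def norm_sgn) (simp add: sgn_eq)
  have c_gx: "c * g x = complex_of_real (cmod (g x)) * s"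
  proof -
    have "cnj (sgn (g x)) * g x = complex_of_real (cmod (g x))"
      using g(2) by (simp add: sgn_eq complex_norm_square[symmetric] power2_eq_square field_simps
          flip: of_real_mult)
    then show ?thesis by (simp add: c_def mult.assoc mult.commute)
  qed
  define h where "h t z = f z + (complex_of_real t * c) * g z" for t z
  have hd: "h t \<in> dual" for t unfolding h_def by (rule dual_add_scaled[OF fd g(1)])
  have h_x: "cmod (h t x) = cmod (f x) + t * cmod (g x)" if "t \<ge> 0" for t
  proof -
    have "h t x = complex_of_real (cmod (f x) + t * cmod (g x)) * s"
      using s(2) c_gx by (simp add: h_def algebra_simps)
    then have "cmod (h t x) = \<bar>cmod (f x) + t * cmod (g x)\<bar>"
      using s(1) by (simp only: norm_mult norm_of_real mult_1_right)
    then show ?thesis using that by simp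
  qed
  have x0: "x \<noteq> 0" using g(1,2) dual_scaleC[OF g(1), of 0 0] by auto
  define K where "K = onorm (\<lambda>z. c * g z)"
  have cgd: "bounded_linear (\<lambda>z. c * g z)"
    using g(1) by (auto simp: dual_def intro: bounded_linear_const_mult)
  have step: "onorm (h t) \<le> onorm (h t') + \<bar>t - t'\<bar> * K" for t t'
  proof -
    have "h t = (\<lambda>z. h t' z + (t - t') *\<^sub>R (c * g z))"
      by (rule ext) (simp add: h_def scaleR_conv_of_real algebra_simps)
    then have "onorm (h t) \<le> onorm (h t') + onorm (\<lambda>z. (t - t') *\<^sub>R (c * g z))"
      using onorm_triangle[OF dual_bounded_linear[OF hd[of t']]
          bounded_linear_scaleR_right[THEN bounded_linear_compose, OF cgd, of "t - t'"]]
      by simp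
    then show ?thesis using onorm_scaleR[OF cgd, of "t - t'"] by (simp add: K_def)
  qed
  have "K-lipschitz_on UNIV (\<lambda>t. onorm (h t))"
  proof (rule lipschitz_onI)
    show "dist (onorm (h t)) (onorm (h t')) \<le> K * dist t t'" for t t'
      using step[of t t'] step[of t' t] by (simp add: dist_real_def abs_minus_commute mult.commute)
    show "0 \<le> K" unfolding K_def by (rule onorm_pos_le[OF cgd])
  qed
  then have cont: "continuous_on UNIV (\<lambda>t. onorm (h t))" by (rule lipschitz_on_continuous_on)
  (* At T the value at x alone, at least T * cmod (g x) = norm x, forces the norm to be at least 1. *)
  define T where "T = norm x / cmod (g x)"
  have T: "T \<ge> 0" by (simp add: T_def)
  have start: "onorm (h 0) \<le> 1" using f1 by (simp add: h_def[abs_def])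
  have "1 \<le> onorm (h T)"
  proof -
    have "norm x \<le> cmod (h T x)" using h_x[OF T] g(2) by (simp add: T_def)
    also have "\<dots> \<le> onorm (h T) * norm x" by (rule dual_norm_le[OF hd])
    finally show ?thesis using x0 by simp
  qed
  then obtain t where t: "0 \<le> t" "onorm (h t) = 1"
    using IVT'[of "\<lambda>t. onorm (h t)" 0 1 T] start T continuous_on_subset[OF cont subset_UNIV] by blast
  show ?thesis
  proof
    show "h t \<in> dual_sphere" using hd t(2) by (simp add: dual_sphere_def)
    show "cmod (f x) \<le> cmod (h t x)" using h_x[OF t(1)] t(1) by simp
    show "h t y = f y" if "y \<in> Y" for y using g(3)[OF that] by (simp add: h_def)
  qed
qed

section \<open>The two infima\<close>

lemma norming_subset: "norming A \<delta> x \<subseteq> A"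
  by (auto simp: norming_def)

lemma norming_mono: "A \<subseteq> B \<Longrightarrow> norming A \<delta> x \<subseteq> norming B \<delta> x"
  by (auto simp: norming_def)

lemma norming_sphere_nonempty:
  fixes x :: "'a::complex_normed_vector"
  assumes "x \<noteq> 0" "0 \<le> \<delta>" shows "norming dual_sphere \<delta> x \<noteq> {}"
proof -
  obtain f where "f \<in> dual_sphere" "cmod (f x) = norm x"
    using exists_norming_functional[OF assms(1)] .
  then have "f \<in> norming dual_sphere \<delta> x"
    using assms(2) by (simp add: norming_def mult_left_le_one_le algebra_simps)
  then show ?thesis by blast
qed

lemma norming_ball_nonempty:
  "x \<noteq> 0 \<Longrightarrow> 0 \<le> \<delta> \<Longrightarrow> norming dual_ball \<delta> x \<noteq> {}"
  using norming_sphere_nonempty[of x \<delta>] norming_mono[OF dual_sphere_subset_ball, of \<delta> x] by blast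

lemma bdd_below_onorm_on:
  assumes "csubspace Y" "A \<subseteq> dual" shows "bdd_below (onorm_on Y ` A)"
  using assms by (intro bdd_belowI2[of _ 0]) (auto intro: onorm_on_nonneg)

lemma m_tilde_le: "csubspace Y \<Longrightarrow> f \<in> norming dual_sphere \<delta> x \<Longrightarrow> m_tilde \<delta> x Y \<le> onorm_on Y f"
  unfolding m_tilde_def
  by (intro cINF_lower bdd_below_onorm_on) (auto simp: norming_def dual_sphere_def)

lemma m_ball_le: "csubspace Y \<Longrightarrow> f \<in> norming dual_ball \<delta> x \<Longrightarrow> m_ball \<delta> x Y \<le> onorm_on Y f"
  unfolding m_ball_def
  by (intro cINF_lower bdd_below_onorm_on) (auto simp: norming_def dual_ball_def)

lemma m_ball_nonneg: "csubspace Y \<Longrightarrow> x \<noteq> 0 \<Longrightarrow> 0 \<le> \<delta> \<Longrightarrow> 0 \<le> m_ball \<delta> x Y"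
  unfolding m_ball_def
  by (intro cINF_greatest norming_ball_nonempty)
    (auto simp: norming_def dual_ball_def intro: onorm_on_nonneg)

text \<open>If \<open>x\<close> lay in \<open>Y\<close>, every competitor would already have norm at least \<open>1 - \<delta>\<close> on the line
  through \<open>x\<close>.\<close>

lemma not_in_subspace_if_m_tilde_less:
  fixes x :: "'a::complex_normed_vector"
  assumes "x \<noteq> 0" "0 \<le> \<delta>" and less: "m_tilde \<delta> x Y < 1 - \<delta>"
  shows "x \<notin> Y"
proof
  assume x: "x \<in> Y"
  have "1 - \<delta> \<le> m_tilde \<delta> x Y"
    unfolding m_tilde_def
  proof (rule cINF_greatest[OF norming_sphere_nonempty[OF assms(1,2)]])
    fix f assume "f \<in> norming dual_sphere \<delta> x"
    then have "f \<in> dual" "(1 - \<delta>) * norm x \<le> cmod (f x)"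
      by (auto simp: norming_def dual_sphere_def)
    then have "(1 - \<delta>) * norm x \<le> onorm_on Y f * norm x"
      using dual_norm_le_onorm_on[OF _ x, of f] by linarith
    then show "1 - \<delta> \<le> onorm_on Y f" using assms(1) by simp
  qed
  with less show False by simp
qed

text \<open>This reduces a bound on \<open>m_ball\<close> to a condition on one vector of \<open>Y\<close> at a time.\<close>

lemma exists_norming_ball_onorm_on_le:
  fixes x :: "'a::complex_normed_vector"
  assumes Y: "csubspace Y" and "0 \<le> \<mu>"
    and "\<And>y. y \<in> Y \<Longrightarrow> (1 - \<delta>) * norm x \<le> norm (x - y) + \<mu> * norm y"
  obtains f where "f \<in> norming dual_ball \<delta> x" "onorm_on Y f \<le> \<mu>"
proof -
  obtain f where "f \<in> dual_ball" "(1 - \<delta>) * norm x \<le> cmod (f x)"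
      "\<And>y. y \<in> Y \<Longrightarrow> cmod (f y) \<le> \<mu> * norm y"
    using restricted_norming_functional[OF assms] by blast
  moreover have "Y \<noteq> {}" using complex_vector.subspace_0[OF Y] by blast
  ultimately show ?thesis
    using that[of f] onorm_on_le[of Y \<mu> f] assms(2) by (simp add: norming_def)
qed

text \<open>For a fixed \<open>y\<close>, every competitor gives the condition of the previous lemma with \<open>\<mu>\<close> its norm
  on \<open>Y\<close>. The condition is affine in \<open>\<mu>\<close>, so it passes to the infimum.\<close>

theorem m_ball_attained:
  fixes x :: "'a::complex_normed_vector"
  assumes Y: "csubspace Y" and x: "x \<noteq> 0" and \<delta>: "0 \<le> \<delta>"
  obtains f where "f \<in> norming dual_ball \<delta> x" "onorm_on Y f = m_ball \<delta> x Y"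
proof -
  have "(1 - \<delta>) * norm x \<le> norm (x - y) + m_ball \<delta> x Y * norm y" if y: "y \<in> Y" for y
  proof -
    have "(1 - \<delta>) * norm x - norm (x - y) \<le> norm y * (m_ball \<delta> x Y)"
    proof (cases "y = 0")
      case True
      then show ?thesis using \<delta> by (simp add: algebra_simps)
    next
      case False
      show ?thesis
        unfolding m_ball_def
      proof (rule mult_cINF_ge[OF norming_ball_nonempty[OF x \<delta>]])
        fix f assume "f \<in> norming dual_ball \<delta> x"
        then have f: "f \<in> dual_ball" "f \<in> dual" "(1 - \<delta>) * norm x \<le> cmod (f x)"
          by (auto simp: norming_def dual_ball_def)
        show "(1 - \<delta>) * norm x - norm (x - y) \<le> norm y * onorm_on Y f"
          using dual_ball_split_norm[OF f(1) dual_norm_le_onorm_on[OF f(2) y], of x] f(3)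
          by (simp add: mult.commute)
      qed (use False in simp)
    qed
    then show ?thesis by (simp add: mult.commute)
  qed
  then obtain f where "f \<in> norming dual_ball \<delta> x" "onorm_on Y f \<le> m_ball \<delta> x Y"
    using exists_norming_ball_onorm_on_le[OF Y m_ball_nonneg[OF Y x \<delta>]] by blast
  then show ?thesis using that m_ball_le[OF Y] by (blast intro: antisym)
qed

text \<open>A minimiser over the ball, pushed to the sphere along an annihilator of \<open>Y\<close>, keeps its
  norm on \<open>Y\<close> and so also minimises over the smaller set.\<close>

theorem m_tilde_attained:
  fixes x :: "'a::complex_normed_vector"
  assumes Y: "csubspace Y" "closed Y" and x: "x \<notin> Y" and \<delta>: "0 \<le> \<delta>"
  obtains f where "f \<in> norming dual_sphere \<delta> x" "onorm_on Y f = m_tilde \<delta> x Y"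
    "m_tilde \<delta> x Y = m_ball \<delta> x Y"
proof -
  have x0: "x \<noteq> 0" using x complex_vector.subspace_0[OF Y(1)] by blast
  obtain f where f: "f \<in> norming dual_ball \<delta> x" "onorm_on Y f = m_ball \<delta> x Y"
    using m_ball_attained[OF Y(1) x0 \<delta>] .
  obtain g where g: "g \<in> dual" "g x \<noteq> 0" "\<And>y. y \<in> Y \<Longrightarrow> g y = 0"
    using exists_annihilator[OF Y x] by blast
  have "f \<in> dual_ball" using f(1) norming_subset by blast
  then obtain h where h: "h \<in> dual_sphere" "cmod (f x) \<le> cmod (h x)" "\<And>y. y \<in> Y \<Longrightarrow> h y = f y"
    using push_to_sphere[OF _ g] by blast
  have hn: "h \<in> norming dual_sphere \<delta> x" using f(1) h(1,2) by (simp add: norming_def)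
  have heq: "onorm_on Y h = m_ball \<delta> x Y" using onorm_on_cong[of Y h f] h(3) f(2) by simp
  have "m_tilde \<delta> x Y \<le> m_ball \<delta> x Y" using m_tilde_le[OF Y(1) hn] heq by simp
  moreover have "m_ball \<delta> x Y \<le> m_tilde \<delta> x Y"
    unfolding m_tilde_def
  proof (rule cINF_greatest[OF norming_sphere_nonempty[OF x0 \<delta>]])
    show "m_ball \<delta> x Y \<le> onorm_on Y k" if "k \<in> norming dual_sphere \<delta> x" for k
      using m_ball_le[OF Y(1)] norming_mono[OF dual_sphere_subset_ball] that by blast
  qed
  ultimately show ?thesis using that[OF hn] heq by simp
qed

section \<open>Approximate orthogonality to a subspace\<close>

lemma approx_orth_subspace_if_onorm_on_le:
  fixes x :: "'a::complex_normed_vector"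
  assumes f: "f \<in> norming dual_sphere \<delta> x" and le: "onorm_on Y f \<le> \<epsilon> / (1 - \<delta>)"
  shows "approx_orth_subspace \<delta> \<epsilon> x Y"
  unfolding approx_orth_subspace_def approx_orth_def
proof (intro ballI bexI conjI)
  have fd: "f \<in> dual" and f1: "onorm f = 1" using f by (auto simp: norming_def dual_sphere_def)
  then show "f \<in> dual - {\<lambda>_. 0}" by (auto simp: onorm_zero)
  show "(1 - \<delta>) * onorm f * norm x \<le> cmod (f x)" using f f1 by (simp add: norming_def)
  show "cmod (f y) \<le> \<epsilon> / (1 - \<delta>) * onorm f * norm y" if "y \<in> Y" for y
    using order_trans[OF dual_norm_le_onorm_on[OF fd that] mult_right_mono[OF le norm_ge_zero]] f1
    by simp
qed

text \<open>The witness \<open>f\<close>, which depends on \<open>y\<close>, disappears after splitting \<open>f x = f (x - y) + f y\<close>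
  and dividing by its norm; what remains can be used for all \<open>y\<close> simultaneously.\<close>

lemma approx_orth_imp_norm_bound:
  fixes x :: "'a::complex_normed_vector"
  assumes "approx_orth \<delta> \<epsilon> x y"
  shows "(1 - \<delta>) * norm x \<le> norm (x - y) + \<epsilon> / (1 - \<delta>) * norm y"
proof -
  obtain f where f: "f \<in> dual" "f \<noteq> (\<lambda>_. 0)" "(1 - \<delta>) * onorm f * norm x \<le> cmod (f x)"
      "cmod (f y) \<le> \<epsilon> / (1 - \<delta>) * onorm f * norm y"
    using assms by (auto simp: approx_orth_def)
  have "onorm f \<noteq> 0" using onorm_eq_0[OF dual_bounded_linear[OF f(1)]] f(2) by auto
  then have pos: "onorm f > 0" using onorm_pos_le[OF dual_bounded_linear[OF f(1)]] by simp
  have "f x = f (x - y) + f y"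
    using dual_bounded_linear[OF f(1)] by (simp add: bounded_linear.linear linear_diff)
  then have "cmod (f x) \<le> cmod (f (x - y)) + cmod (f y)" by (metis norm_triangle_ineq)
  also have "\<dots> \<le> onorm f * norm (x - y) + \<epsilon> / (1 - \<delta>) * onorm f * norm y"
    using dual_norm_le[OF f(1), of "x - y"] f(4) by linarith
  finally have "onorm f * ((1 - \<delta>) * norm x)
      \<le> onorm f * (norm (x - y) + \<epsilon> / (1 - \<delta>) * norm y)"
    using f(3) by (simp add: algebra_simps)
  then show ?thesis using pos by simp
qed

text \<open>The bounds for the single vectors \<open>y\<close> are all that the Hahn--Banach argument needs to produce
  one functional for the whole of \<open>Y\<close>.\<close>

theorem m_ball_le_if_approx_orth_subspace:
  fixes x :: "'a::complex_normed_vector"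
  assumes Y: "csubspace Y" and "0 \<le> \<epsilon>" "\<delta> < 1" and orth: "approx_orth_subspace \<delta> \<epsilon> x Y"
  shows "m_ball \<delta> x Y \<le> \<epsilon> / (1 - \<delta>)"
proof -
  have "0 \<le> \<epsilon> / (1 - \<delta>)" using assms by simp
  moreover have "(1 - \<delta>) * norm x \<le> norm (x - y) + \<epsilon> / (1 - \<delta>) * norm y" if "y \<in> Y" for y
    by (rule approx_orth_imp_norm_bound) (use orth that in \<open>simp add: approx_orth_subspace_def\<close>)
  ultimately obtain f where "f \<in> norming dual_ball \<delta> x" "onorm_on Y f \<le> \<epsilon> / (1 - \<delta>)"
    using exists_norming_ball_onorm_on_le[OF Y] by blast
  then show ?thesis using m_ball_le[OF Y] by (blast intro: order_trans)
qed

theorem proposition3p4: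
  fixes x :: "'a::complex_normed_vector" and Y :: "'a set" and \<delta> :: real
  assumes "csubspace Y" and "closed Y" and "Y \<noteq> UNIV" and "Y \<noteq> {0}"
    and "x \<noteq> 0"
    and "0 \<le> \<delta>" and "\<delta> < 1"
    and "m_tilde \<delta> x Y < 1 - \<delta>"
  shows "(x \<notin> Y \<and>
      (\<exists>f\<in>norming dual_sphere \<delta> x. onorm_on Y f = m_tilde \<delta> x Y) \<and>
      (\<exists>f\<in>norming dual_ball \<delta> x. onorm_on Y f = m_ball \<delta> x Y)) \<and>
    (\<exists>\<epsilon>_min\<in>{\<epsilon> \<in> {0..<(1 - \<delta>)\<^sup>2}. approx_orth_subspace \<delta> \<epsilon> x Y}.
      (\<forall>\<epsilon>\<in>{\<epsilon> \<in> {0..<(1 - \<delta>)\<^sup>2}. approx_orth_subspace \<delta> \<epsilon> x Y}. \<epsilon>_min \<le> \<epsilon>) \<and>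
      \<epsilon>_min = (1 - \<delta>) * m_tilde \<delta> x Y \<and>
      (1 - \<delta>) * m_ball \<delta> x Y \<le> \<epsilon>_min \<and> \<epsilon>_min \<le> m_ball \<delta> x Y) \<and>
    (m_ball \<delta> x Y < (1 - \<delta>)\<^sup>2 \<longrightarrow> approx_orth_subspace \<delta> (m_ball \<delta> x Y) x Y)"
proof -
  let ?m = "m_ball \<delta> x Y"
  let ?S = "{\<epsilon> \<in> {0..<(1 - \<delta>)\<^sup>2}. approx_orth_subspace \<delta> \<epsilon> x Y}"
  have \<delta>: "0 \<le> \<delta>" "1 - \<delta> > 0" "1 - \<delta> \<le> 1" using assms by auto
  have x: "x \<notin> Y" using not_in_subspace_if_m_tilde_less assms by blast
  obtain f where f: "f \<in> norming dual_sphere \<delta> x" "onorm_on Y f = m_tilde \<delta> x Y"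
    and eq: "m_tilde \<delta> x Y = ?m"
    using m_tilde_attained[OF assms(1,2) x \<delta>(1)] .
  obtain g where g: "g \<in> norming dual_ball \<delta> x" "onorm_on Y g = ?m"
    using m_ball_attained[OF assms(1,5) \<delta>(1)] .
  have m0: "0 \<le> ?m" by (rule m_ball_nonneg[OF assms(1,5) \<delta>(1)])
  have m_le: "(1 - \<delta>) * ?m \<le> ?m" using m0 \<delta> by (simp add: mult_left_le_one_le)
  have orth: "approx_orth_subspace \<delta> \<epsilon> x Y" if "(1 - \<delta>) * ?m \<le> \<epsilon>" for \<epsilon>
    by (rule approx_orth_subspace_if_onorm_on_le[OF f(1)])
      (use that f(2) eq \<delta>(2) in \<open>simp add: field_simps\<close>)
  have "(1 - \<delta>) * ?m < (1 - \<delta>)\<^sup>2"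
    using assms(8) eq \<delta>(2) by (simp add: power2_eq_square)
  then have mem: "(1 - \<delta>) * ?m \<in> ?S" using m0 \<delta>(2) orth by simp
  have least: "(1 - \<delta>) * ?m \<le> \<epsilon>" if "\<epsilon> \<in> ?S" for \<epsilon>
    using m_ball_le_if_approx_orth_subspace[OF assms(1) _ assms(7), of \<epsilon> x] that \<delta>(2)
    by (simp add: field_simps)
  have "\<exists>\<epsilon>_min\<in>?S. (\<forall>\<epsilon>\<in>?S. \<epsilon>_min \<le> \<epsilon>) \<and> \<epsilon>_min = (1 - \<delta>) * m_tilde \<delta> x Y \<and>
      (1 - \<delta>) * ?m \<le> \<epsilon>_min \<and> \<epsilon>_min \<le> ?m"
    using mem least m_le eq by (intro bexI[of _ "(1 - \<delta>) * ?m"]) auto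
  then show ?thesis using x f g orth[OF m_le] by blast
qed

end
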